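(* Let $k\ge2$ and let $(\sigma_1,\dots,\sigma_k)$ be an allowable sequence with $\sigma_1,\dots,\sigma_k\in\mathfrak{S}_n$. Then there exists a standard permuted composition tableau $\tau$ of shape $(k^n)$ such that $\mathrm{st}_i(\tau)=\sigma_i$ for all $1\le i\le k$.
   Context: For $\sigma,\gamma\in\mathfrak{S}_n$, the pair $(\sigma,\gamma)$ is allowable if (a) for all $1\le i<j\le n$, $\sigma(i)>\sigma(j)$ implies $\gamma(i)>\gamma(j)$, and (b) for all $1\le i<j<l\le n$ with $\sigma(i)<\sigma(j)<\sigma(l)$, it is not the case that $\gamma(j)<\gamma(l)<\gamma(i)$. A sequence $(\sigma_1,\dots,\sigma_k)$ is allowable if each consecutive pair $(\sigma_j,\sigma_{j+1})$ is allowable. A standard permuted composition tableau of shape $(k^n)$ is a filling $\tau$ of the $n\times k$ array ($n$ rows, each with $k$ cells) with the distinct integers $1,\dots,kn$ such that rows decrease from left to right and (triple condition) whenever $i<r$ and the cells $(i,j),(i,j+1),(r,j+1)$ have entries $a,b,c$, $a\ge c$ implies $b>c$. For $1\le j\le k$, $\mathrm{st}_j(\tau)\in\mathfrak{S}_n$ is the standardization of the $j$-th column read top to bottom, i.e. the unique $\pi\in\mathfrak{S}_n$ with $\pi(i)>\pi(r)$ iff the entry of row $i$ exceeds that of row $r$ in column $j$. *)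

theory Defs
  imports "HOL-Combinatorics.Permutations"
begin

text \<open>
  Elements of the symmetric group on \<open>n\<close> letters are functions \<open>\<sigma> :: nat \<Rightarrow> nat\<close> with
  \<open>\<sigma> permutes {1..n}\<close>. A sequence \<open>(\<sigma>\<^sub>1, \<dots>, \<sigma>\<^sub>k)\<close> is a function whose values at
  \<open>1, \<dots>, k\<close> are the members of the sequence. A filling of the \<open>n \<times> k\<close> array is a function
  \<open>\<tau>\<close> with \<open>\<tau> i j\<close> the entry in row \<open>i\<close> (counted from the top) and column \<open>j\<close>; only its
  values for \<open>1 \<le> i \<le> n\<close> and \<open>1 \<le> j \<le> k\<close> matter.
\<close>

definition allowable_pair :: "nat \<Rightarrow> (nat \<Rightarrow> nat) \<Rightarrow> (nat \<Rightarrow> nat) \<Rightarrow> bool" where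
  "allowable_pair n \<sigma> \<gamma> \<longleftrightarrow>
     (\<forall>i j. 1 \<le> i \<and> i < j \<and> j \<le> n \<longrightarrow> \<sigma> i > \<sigma> j \<longrightarrow> \<gamma> i > \<gamma> j) \<and>
     (\<forall>i j l. 1 \<le> i \<and> i < j \<and> j < l \<and> l \<le> n \<longrightarrow> \<sigma> i < \<sigma> j \<and> \<sigma> j < \<sigma> l \<longrightarrow>
        \<not> (\<gamma> j < \<gamma> l \<and> \<gamma> l < \<gamma> i))"

definition allowable_sequence :: "nat \<Rightarrow> nat \<Rightarrow> (nat \<Rightarrow> nat \<Rightarrow> nat) \<Rightarrow> bool" where
  "allowable_sequence n k \<sigma> \<longleftrightarrow> (\<forall>j. 1 \<le> j \<and> j < k \<longrightarrow> allowable_pair n (\<sigma> j) (\<sigma> (j + 1)))"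

definition rows_decreasing :: "nat \<Rightarrow> nat \<Rightarrow> (nat \<Rightarrow> nat \<Rightarrow> nat) \<Rightarrow> bool" where
  "rows_decreasing n k \<tau> \<longleftrightarrow>
     (\<forall>i j. 1 \<le> i \<and> i \<le> n \<and> 1 \<le> j \<and> j < k \<longrightarrow> \<tau> i j > \<tau> i (j + 1))"

definition triple_condition :: "nat \<Rightarrow> nat \<Rightarrow> (nat \<Rightarrow> nat \<Rightarrow> nat) \<Rightarrow> bool" where
  "triple_condition n k \<tau> \<longleftrightarrow>
     (\<forall>i r j. 1 \<le> i \<and> i < r \<and> r \<le> n \<and> 1 \<le> j \<and> j < k \<longrightarrow>
        \<tau> i j \<ge> \<tau> r (j + 1) \<longrightarrow> \<tau> i (j + 1) > \<tau> r (j + 1))"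

definition standard_PCT :: "nat \<Rightarrow> nat \<Rightarrow> (nat \<Rightarrow> nat \<Rightarrow> nat) \<Rightarrow> bool" where
  "standard_PCT n k \<tau> \<longleftrightarrow>
     bij_betw (\<lambda>(i, j). \<tau> i j) ({1..n} \<times> {1..k}) {1..k * n} \<and>
     rows_decreasing n k \<tau> \<and> triple_condition n k \<tau>"

definition standardization :: "nat \<Rightarrow> (nat \<Rightarrow> nat) \<Rightarrow> nat \<Rightarrow> nat" where
  "standardization n c =
     (THE \<pi>. \<pi> permutes {1..n} \<and> (\<forall>i\<in>{1..n}. \<forall>r\<in>{1..n}. \<pi> i > \<pi> r \<longleftrightarrow> c i > c r))"

definition column_st :: "nat \<Rightarrow> (nat \<Rightarrow> nat \<Rightarrow> nat) \<Rightarrow> nat \<Rightarrow> nat \<Rightarrow> nat" where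
  "column_st n \<tau> j = standardization n (\<lambda>i. \<tau> i j)"

text \<open>The description in the definition of \<^const>\<open>standardization\<close> is proper.\<close>

lemma standardization_ex1:
  fixes c :: "nat \<Rightarrow> nat"
  assumes inj: "inj_on c {1..n}"
  shows "\<exists>!\<pi>. \<pi> permutes {1..n} \<and> (\<forall>i\<in>{1..n}. \<forall>r\<in>{1..n}. \<pi> i > \<pi> r \<longleftrightarrow> c i > c r)"
proof (rule ex_ex1I)
  define L where "L i = {r \<in> {1..n}. c r \<le> c i}" for i
  define \<pi> where "\<pi> i = (if i \<in> {1..n} then card (L i) else i)" for i
  have fin: "finite (L i)" for i by (simp add: L_def)
  have less: "card (L r) < card (L i)" if "i \<in> {1..n}" "c r < c i" for i r
  proof (intro psubset_card_mono fin psubsetI)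
    show "L r \<subseteq> L i" using that by (auto simp: L_def)
    have "i \<in> L i" "i \<notin> L r" using that by (auto simp: L_def)
    then show "L r \<noteq> L i" by blast
  qed
  have iff: "\<pi> i > \<pi> r \<longleftrightarrow> c i > c r" if ir: "i \<in> {1..n}" "r \<in> {1..n}" for i r
  proof -
    have eq: "\<pi> i = card (L i)" "\<pi> r = card (L r)" using that by (simp_all add: \<pi>_def)
    consider "c r < c i" | "c i < c r" | "i = r"
      using inj_onD[OF inj _ ir] linorder_less_linear[of "c i" "c r"] by blast
    then show ?thesis
    proof cases
      case 1
      then show ?thesis using less[of i r] ir eq by simp
    next
      case 2
      then show ?thesis using less[of r i] ir eq by simp
    next
      case 3
      then show ?thesis by simp
    qed
  qed
  have inj': "inj_on \<pi> {1..n}"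
  proof (intro inj_onI)
    fix i r assume "i \<in> {1..n}" "r \<in> {1..n}" "\<pi> i = \<pi> r"
    then have "c i = c r" using iff[of i r] iff[of r i] by linarith
    then show "i = r" using \<open>i \<in> {1..n}\<close> \<open>r \<in> {1..n}\<close> by (rule inj_onD[OF inj])
  qed
  have "\<pi> i \<in> {1..n}" if i: "i \<in> {1..n}" for i
  proof -
    have "i \<in> L i" "L i \<subseteq> {1..n}" using i by (auto simp: L_def)
    then have "card (L i) > 0" "card (L i) \<le> card {1..n}"
      using fin by (auto simp: card_gt_0_iff simp del: card_atLeastAtMost intro: card_mono)
    then show ?thesis using i by (simp add: \<pi>_def)
  qed
  then have "\<pi> ` {1..n} = {1..n}" by (intro endo_inj_surj inj') auto
  then have "\<pi> permutes {1..n}"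
    using inj' by (intro bij_imp_permutes) (auto simp: bij_betw_def \<pi>_def)
  then show "\<exists>\<pi>. \<pi> permutes {1..n} \<and> (\<forall>i\<in>{1..n}. \<forall>r\<in>{1..n}. \<pi> i > \<pi> r \<longleftrightarrow> c i > c r)"
    using iff by blast
next
  have rank: "\<pi> i = card {r \<in> {1..n}. c r \<le> c i}"
    if p: "\<pi> permutes {1..n}"
      and o: "\<forall>i\<in>{1..n}. \<forall>r\<in>{1..n}. \<pi> i > \<pi> r \<longleftrightarrow> c i > c r" and i: "i \<in> {1..n}" for \<pi> i
  proof -
    have m: "\<pi> i \<in> {1..n}" using permutes_in_image[OF p] i by blast
    have "\<pi> ` {r \<in> {1..n}. c r \<le> c i} = {1..\<pi> i}"
    proof (intro equalityI subsetI)
      fix x assume "x \<in> \<pi> ` {r \<in> {1..n}. c r \<le> c i}"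
      then obtain r where r: "r \<in> {1..n}" "c r \<le> c i" "x = \<pi> r" by blast
      have "\<pi> r \<in> {1..n}" using permutes_in_image[OF p] r by blast
      moreover have "\<not> \<pi> r > \<pi> i" using o i r(1,2) by (meson not_less)
      ultimately show "x \<in> {1..\<pi> i}" using r(3) by simp
    next
      fix x assume x: "x \<in> {1..\<pi> i}"
      then have "x \<in> \<pi> ` {1..n}" using m permutes_image[OF p] by auto
      then obtain r where r: "r \<in> {1..n}" "x = \<pi> r" by blast
      then have "\<not> \<pi> r > \<pi> i" using x by simp
      then have "c r \<le> c i" using o i r(1) by (meson not_less)
      then show "x \<in> \<pi> ` {r \<in> {1..n}. c r \<le> c i}" using r by blast
    qed
    moreover have "card (\<pi> ` {r \<in> {1..n}. c r \<le> c i}) = card {r \<in> {1..n}. c r \<le> c i}"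
      by (intro card_image inj_on_subset[OF permutes_inj[OF p]] subset_UNIV)
    ultimately have "card {1..\<pi> i} = card {r \<in> {1..n}. c r \<le> c i}" by (rule subst)
    then show ?thesis by simp
  qed
  fix \<pi> \<rho>
  assume \<pi>: "\<pi> permutes {1..n} \<and> (\<forall>i\<in>{1..n}. \<forall>r\<in>{1..n}. \<pi> i > \<pi> r \<longleftrightarrow> c i > c r)"
    and \<rho>: "\<rho> permutes {1..n} \<and> (\<forall>i\<in>{1..n}. \<forall>r\<in>{1..n}. \<rho> i > \<rho> r \<longleftrightarrow> c i > c r)"
  show "\<pi> = \<rho>"
  proof
    fix i
    show "\<pi> i = \<rho> i"
    proof (cases "i \<in> {1..n}")
      case True
      then show ?thesis
        using rank[OF conjunct1[OF \<pi>] conjunct2[OF \<pi>] True]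
          rank[OF conjunct1[OF \<rho>] conjunct2[OF \<rho>] True] by (simp only:)
    next
      case False
      then show ?thesis
        using permutes_not_in[OF conjunct1[OF \<pi>] False]
          permutes_not_in[OF conjunct1[OF \<rho>] False] by (simp only:)
    qed
  qed
qed

end

theory Submission
  imports Defs
begin

text \<open>
  For distinct entries the triple condition says that \<open>\<tau> i j < \<tau> r (j + 1)\<close> whenever \<open>i < r\<close>
  and row \<open>i\<close> is below row \<open>r\<close> in column \<open>j + 1\<close>; so all requirements are strict inequalities
  inside a column or between adjacent columns, and the tableau can be built column by column.
  Given column \<open>c\<close>, ordered like \<open>s\<close>, put the entry of row \<open>r\<close> of the next column, to be ordered
  like \<open>g\<close>, just below the minimum of the \<open>c m\<close> with \<open>g m \<ge> g r\<close>. This meets every upper bound,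
  and allowability of \<open>(s, g)\<close> is exactly what makes the lower bounds hold. Multiplying the old
  entries by \<open>n + 1\<close> makes room for the new ones, and a final ranking makes the entries
  \<open>1, \<dots>, kn\<close>.
\<close>

text \<open>By the contrapositive of (a), \<open>s\<close> increases along any positions
  \<open>p < q\<close> with \<open>g p < g q\<close>; this settles \<open>i < m\<close> and gives
  \<open>s i < s r\<close>. If \<open>m < i\<close>, then \<open>s m < s i < s r\<close> would make
  \<open>m\<close>, \<open>i\<close>, \<open>r\<close> a pattern forbidden by (b).\<close>

lemma allowable_pair_lower_bound:
  assumes allow: "allowable_pair n s g"
    and s: "inj_on s {1..n}" and inj_g: "inj_on g {1..n}"
    and i: "1 \<le> i" "i < r" "r \<le> n" and g: "g i < g r"
    and m: "m \<in> {1..n}" "g r \<le> g m"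
  shows "s i < s m"
proof -
  have mono: "s p < s q" if "1 \<le> p" "p < q" "q \<le> n" "g p < g q" for p q
  proof -
    have "\<not> s p > s q"
      using allow that unfolding allowable_pair_def by (meson less_asym)
    moreover have "s p \<noteq> s q"
      using inj_onD[OF s, of p q] that by auto
    ultimately show ?thesis by simp
  qed
  consider "i < m" | "i = m" | "m < i" by linarith
  then show ?thesis
  proof cases
    case 1
    then show ?thesis using mono[of i m] i g m by auto
  next
    case 2
    then show ?thesis using g m by simp
  next
    case 3
    \<comment> \<open>Condition (b) needs \<open>g r < g m\<close> strictly, and \<open>m\<close>
      differs from \<open>r\<close> because \<open>m < i < r\<close>.\<close>
    then have "g m \<noteq> g r" using inj_onD[OF inj_g, of m r] i m by auto
    then have "\<not> (s m < s i \<and> s i < s r)"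
      using allow 3 i g m unfolding allowable_pair_def
      by (metis atLeastAtMost_iff le_neq_implies_less)
    moreover have "s i < s r" using mono i g by blast
    moreover have "s m \<noteq> s i" using inj_onD[OF s, of m i] 3 i m by auto
    ultimately show ?thesis by linarith
  qed
qed

text \<open>Old entries are compared after scaling by \<open>Suc n\<close>. Non-divisibility of
  \<open>d i\<close> by \<open>Suc n\<close> will separate new entries from all scaled old ones and
  keep them nonzero.\<close>

lemma next_column:
  fixes c s g :: "nat \<Rightarrow> nat"
  assumes allow: "allowable_pair n s g"
    and s: "inj_on s {1..n}" and g: "g permutes {1..n}"
    and order: "\<And>i r. i \<in> {1..n} \<Longrightarrow> r \<in> {1..n} \<Longrightarrow> c i < c r \<longleftrightarrow> s i < s r"
    and pos: "\<And>i. i \<in> {1..n} \<Longrightarrow> 0 < c i"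
  obtains d :: "nat \<Rightarrow> nat" where
    "\<And>i r. i \<in> {1..n} \<Longrightarrow> r \<in> {1..n} \<Longrightarrow> d i < d r \<longleftrightarrow> g i < g r"
    "\<And>i. i \<in> {1..n} \<Longrightarrow> d i < Suc n * c i"
    "\<And>i. i \<in> {1..n} \<Longrightarrow> \<not> Suc n dvd d i"
    "\<And>i r. 1 \<le> i \<Longrightarrow> i < r \<Longrightarrow> r \<le> n \<Longrightarrow> g i < g r \<Longrightarrow> Suc n * c i < d r"
proof
  define B where "B r = c ` {m \<in> {1..n}. g r \<le> g m}" for r
  \<comment> \<open>Since \<open>g r\<close> is in \<open>{1..n}\<close>, the value lies strictly
    between the multiples of \<open>Suc n\<close> given by \<open>Min (B r) - 1\<close> and
    \<open>Min (B r)\<close>; rows sharing a minimum are ordered by \<open>g\<close>.\<close>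
  define d where "d r = Suc n * (Min (B r) - 1) + g r" for r
  have fin: "finite (B r)" for r by (simp add: B_def)
  have mem: "c r \<in> B r" if "r \<in> {1..n}" for r using that by (auto simp: B_def)
  have gr: "g r \<in> {1..n}" if "r \<in> {1..n}" for r using permutes_in_image[OF g] that by blast
  have Min_pos: "0 < Min (B r)" if "r \<in> {1..n}" for r
  proof -
    have "Min (B r) \<in> B r" using fin mem[OF that] by (intro Min_in) auto
    then show ?thesis using pos by (auto simp: B_def)
  qed
  have less: "d i < d r" if "i \<in> {1..n}" "r \<in> {1..n}" "g i < g r" for i r
  proof -
    \<comment> \<open>\<open>B r\<close> is contained in \<open>B i\<close> because
      \<open>g i < g r\<close>.\<close>
    have "Min (B i) \<le> Min (B r)"
      using mem[OF that(2)] that(3) fin by (intro Min_antimono) (auto simp: B_def)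
    then have "Suc n * (Min (B i) - 1) \<le> Suc n * (Min (B r) - 1)"
      by (intro mult_le_mono2 diff_le_mono)
    then show ?thesis using that(3) by (simp add: d_def)
  qed
  show "d i < d r \<longleftrightarrow> g i < g r" if "i \<in> {1..n}" "r \<in> {1..n}" for i r
    using less[OF that] less[OF that(2,1)] permutes_inj[OF g, THEN injD, of i r]
    by (metis less_asym nat_neq_iff)
  show "d i < Suc n * c i" if "i \<in> {1..n}" for i
  proof -
    have "d i < Suc n * (Min (B i) - 1) + Suc n" using gr[OF that] by (simp add: d_def)
    \<comment> \<open>Positivity of the minimum keeps the truncated subtraction exact.\<close>
    also have "\<dots> = Suc n * Min (B i)"
      using Min_pos[OF that] by (cases "Min (B i)") simp_all
    also have "\<dots> \<le> Suc n * c i" using fin mem[OF that] by (intro mult_le_mono2 Min_le)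
    finally show ?thesis .
  qed
  show "\<not> Suc n dvd d i" if "i \<in> {1..n}" for i
  proof
    assume "Suc n dvd d i"
    then have "Suc n dvd g i" unfolding d_def by (simp only: dvd_add_right_iff dvd_triv_left)
    then show False using gr[OF that] by (auto dest: dvd_imp_le)
  qed
  show "Suc n * c i < d r" if "1 \<le> i" "i < r" "r \<le> n" "g i < g r" for i r
  proof -
    have r: "r \<in> {1..n}" and i: "i \<in> {1..n}" using that by auto
    have "c i < Min (B r)"
    proof (subst Min_gr_iff)
      show "finite (B r)" "B r \<noteq> {}" using fin mem[OF r] by auto
      show "\<forall>x\<in>B r. c i < x"
        using allowable_pair_lower_bound[OF allow s permutes_inj_on[OF g] that] order[OF i] by (auto simp: B_def)
    qed
    then have "c i \<le> Min (B r) - 1" by simp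
    then have "Suc n * c i \<le> Suc n * (Min (B r) - 1)" by (rule mult_le_mono2)
    then show ?thesis using gr[OF r] by (simp add: d_def)
  qed
qed

text \<open>Induction on the number of columns. Entries are only required to be distinct and
  positive, so that they can be rescaled at each step; positivity and the order within columns are
  what \<open>next_column\<close> asks of the last column.\<close>

lemma allowable_sequence_filling:
  assumes "k \<ge> 1"
    and perm: "\<And>j. 1 \<le> j \<Longrightarrow> j \<le> k \<Longrightarrow> \<sigma> j permutes {1..n}"
    and allow: "allowable_sequence n k \<sigma>"
  shows "\<exists>\<tau> :: nat \<Rightarrow> nat \<Rightarrow> nat.
    inj_on (\<lambda>(i, j). \<tau> i j) ({1..n} \<times> {1..k}) \<and>
    (\<forall>i\<in>{1..n}. \<forall>j\<in>{1..k}. 0 < \<tau> i j) \<and>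
    (\<forall>j\<in>{1..k}. \<forall>i\<in>{1..n}. \<forall>r\<in>{1..n}. \<tau> i j < \<tau> r j \<longleftrightarrow> \<sigma> j i < \<sigma> j r) \<and>
    rows_decreasing n k \<tau> \<and> triple_condition n k \<tau>"
  using assms
proof (induction k rule: nat_induct_at_least)
  case base
  have p: "\<sigma> 1 permutes {1..n}" using base by simp
  have "0 < \<sigma> 1 i" if "i \<in> {1..n}" for i
    using permutes_in_image[OF p, of i] that by simp
  \<comment> \<open>The single column is \<sigma> 1 itself; the conditions on adjacent columns are
    vacuous.\<close>
  then show ?case
    using permutes_inj[OF p]
    by (intro exI[of _ "\<lambda>i j. \<sigma> j i"])
      (auto simp: rows_decreasing_def triple_condition_def inj_on_def dest: injD)
next
  case (Suc k)
  have "allowable_sequence n k \<sigma>"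
    using Suc.prems(2) by (simp add: allowable_sequence_def)
  then obtain \<tau> :: "nat \<Rightarrow> nat \<Rightarrow> nat" where
    inj: "inj_on (\<lambda>(i, j). \<tau> i j) ({1..n} \<times> {1..k})" and
    pos: "\<And>i j. i \<in> {1..n} \<Longrightarrow> j \<in> {1..k} \<Longrightarrow> 0 < \<tau> i j" and
    ord: "\<And>j i r. j \<in> {1..k} \<Longrightarrow> i \<in> {1..n} \<Longrightarrow> r \<in> {1..n} \<Longrightarrow>
      \<tau> i j < \<tau> r j \<longleftrightarrow> \<sigma> j i < \<sigma> j r" and
    rows: "rows_decreasing n k \<tau>" and triple: "triple_condition n k \<tau>"
    using Suc.IH Suc.prems by force
  have k: "k \<in> {1..k}" using Suc.hyps by simp
  have g: "\<sigma> (Suc k) permutes {1..n}" and s: "\<sigma> k permutes {1..n}"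
    using Suc by simp_all
  have pair: "allowable_pair n (\<sigma> k) (\<sigma> (Suc k))"
    using Suc.prems(2) k by (auto simp: allowable_sequence_def)
  obtain d :: "nat \<Rightarrow> nat" where
    d_ord: "\<And>i r. i \<in> {1..n} \<Longrightarrow> r \<in> {1..n} \<Longrightarrow> d i < d r \<longleftrightarrow> \<sigma> (Suc k) i < \<sigma> (Suc k) r" and
    d_less: "\<And>i. i \<in> {1..n} \<Longrightarrow> d i < Suc n * \<tau> i k" and
    d_ndvd: "\<And>i. i \<in> {1..n} \<Longrightarrow> \<not> Suc n dvd d i" and
    d_gr: "\<And>i r. 1 \<le> i \<Longrightarrow> i < r \<Longrightarrow> r \<le> n \<Longrightarrow> \<sigma> (Suc k) i < \<sigma> (Suc k) r \<Longrightarrow>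
      Suc n * \<tau> i k < d r"
    by (rule next_column[OF pair permutes_inj_on[OF s] g, of "\<lambda>i. \<tau> i k"])
      (assumption | rule ord[OF k] pos[OF _ k] | blast)+
  define \<rho> where "\<rho> i j = (if j = Suc k then d i else Suc n * \<tau> i j)" for i j
  have \<rho>_old: "\<rho> i j = Suc n * \<tau> i j" if "j \<le> k" for i j using that by (simp add: \<rho>_def)
  have \<rho>_new: "\<rho> i (Suc k) = d i" for i by (simp add: \<rho>_def)
  have d_inj: "i = r" if "i \<in> {1..n}" "r \<in> {1..n}" "d i = d r" for i r
    using d_ord[OF that(1,2)] d_ord[OF that(2,1)] that(3) permutes_inj[OF g, THEN injD, of i r]
    by (metis less_irrefl nat_neq_iff)
  have "inj_on (\<lambda>(i, j). \<rho> i j) ({1..n} \<times> {1..Suc k})"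
  proof (rule inj_onI, clarify)
    fix i j r l
    assume ir: "i \<in> {1..n}" "r \<in> {1..n}" and jl: "j \<in> {1..Suc k}" "l \<in> {1..Suc k}"
      and eq: "\<rho> i j = \<rho> r l"
    \<comment> \<open>Divisibility by \<open>Suc n\<close> tells old columns from the new one, so
      equal entries are both old or both new.\<close>
    have dvd: "Suc n dvd \<rho> p q \<longleftrightarrow> q \<le> k" if "p \<in> {1..n}" "q \<in> {1..Suc k}" for p q
      using d_ndvd[OF that(1)] that(2) by (cases "q = Suc k") (auto simp: \<rho>_def simp del: mult_Suc)
    show "i = r \<and> j = l"
    proof (cases "j \<le> k")
      case True
      then have l: "l \<le> k" using dvd[OF ir(1) jl(1)] dvd[OF ir(2) jl(2)] eq by simp
      then have "\<tau> i j = \<tau> r l" using eq True by (simp only: \<rho>_old nat_mult_eq_cancel_disj) simp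
      then show ?thesis using inj_onD[OF inj, of "(i, j)" "(r, l)"] ir jl l True by auto
    next
      case False
      then have "\<not> l \<le> k" using dvd[OF ir(1) jl(1)] dvd[OF ir(2) jl(2)] eq by simp
      then have "j = Suc k" "l = Suc k" using False jl by auto
      then show ?thesis using d_inj[OF ir] eq by (simp add: \<rho>_new)
    qed
  qed
  moreover have "0 < \<rho> i j" if "i \<in> {1..n}" "j \<in> {1..Suc k}" for i j
    using that pos[of i j] d_ndvd[of i] by (cases "j = Suc k") (auto simp: \<rho>_def intro: gr0I)
  moreover have "\<rho> i j < \<rho> r j \<longleftrightarrow> \<sigma> j i < \<sigma> j r"
    if "j \<in> {1..Suc k}" "i \<in> {1..n}" "r \<in> {1..n}" for i j r
    using that ord[of j i r] d_ord[of i r]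
    by (cases "j = Suc k") (simp_all add: \<rho>_def del: mult_Suc)
  moreover have "rows_decreasing n (Suc k) \<rho>"
    unfolding rows_decreasing_def
  proof (intro allI impI)
    fix i j assume a: "1 \<le> i \<and> i \<le> n \<and> 1 \<le> j \<and> j < Suc k"
    show "\<rho> i j > \<rho> i (j + 1)"
    proof (cases "j = k")
      case True
      then show ?thesis using d_less[of i] a by (simp add: \<rho>_def del: mult_Suc)
    next
      case False
      then show ?thesis using rows a by (simp add: \<rho>_def rows_decreasing_def del: mult_Suc)
    qed
  qed
  moreover have "triple_condition n (Suc k) \<rho>"
    unfolding triple_condition_def
  proof (intro allI impI)
    fix i r j
    assume a: "1 \<le> i \<and> i < r \<and> r \<le> n \<and> 1 \<le> j \<and> j < Suc k" and ge: "\<rho> r (j + 1) \<le> \<rho> i j"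
    show "\<rho> r (j + 1) < \<rho> i (j + 1)"
    proof (cases "j = k")
      case True
      \<comment> \<open>Otherwise \<open>d_gr\<close> would put \<open>d r\<close> above the scaled
        entry of row \<open>i\<close> in column \<open>k\<close>, against \<open>ge\<close>.\<close>
      have "\<not> d i < d r"
        using d_gr[of i r] d_ord[of i r] a ge True by (auto simp: \<rho>_def simp del: mult_Suc)
      moreover have "d i \<noteq> d r" using d_inj[of i r] a by auto
      ultimately show ?thesis using True by (simp add: \<rho>_def)
    next
      case False
      then show ?thesis
        using triple a ge by (simp add: \<rho>_def triple_condition_def del: mult_Suc)
    qed
  qed
  ultimately show ?case by blast
qed

text \<open>Counting the elements of \<open>S\<close> up to \<open>x\<close> relabels
  \<open>S\<close> without changing any comparison.\<close>

lemma finite_rank: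
  fixes S :: "nat set"
  assumes "finite S"
  obtains h :: "nat \<Rightarrow> nat" where "bij_betw h S {1..card S}"
    "\<And>x y. x \<in> S \<Longrightarrow> y \<in> S \<Longrightarrow> h x < h y \<longleftrightarrow> x < y"
proof
  define h where "h x = card {z \<in> S. z \<le> x}" for x
  have less: "h x < h y" if "x < y" "y \<in> S" for x y
  proof -
    have "{z \<in> S. z \<le> x} \<subset> {z \<in> S. z \<le> y}"
      using that by (intro psubsetI) (auto dest!: equalityD2)
    then show ?thesis unfolding h_def using assms by (intro psubset_card_mono) auto
  qed
  show iff: "h x < h y \<longleftrightarrow> x < y" if "x \<in> S" "y \<in> S" for x y
    using less that by (metis less_asym nat_neq_iff)
  have inj: "inj_on h S" using iff by (metis inj_onI less_irrefl nat_neq_iff)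
  have "h ` S \<subseteq> {1..card S}"
    using assms by (auto simp: h_def Suc_le_eq card_gt_0_iff intro!: card_mono)
  then have "h ` S = {1..card S}"
    using card_image[OF inj] by (intro card_subset_eq) auto
  then show "bij_betw h S {1..card S}" using inj by (simp add: bij_betw_def)
qed

text \<open>The order agreement makes \<open>c\<close> injective, so the uniqueness in
  \<open>standardization_ex1\<close> applies.\<close>

lemma standardization_eqI:
  assumes "\<pi> permutes {1..n}"
    and ord: "\<And>i r. i \<in> {1..n} \<Longrightarrow> r \<in> {1..n} \<Longrightarrow> c i < c r \<longleftrightarrow> \<pi> i < \<pi> r"
  shows "standardization n c = \<pi>"
proof -
  have "inj_on c {1..n}"
    using ord permutes_inj[OF assms(1)] by (metis inj_onI injD less_irrefl nat_neq_iff)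
  from standardization_ex1[OF this] show ?thesis
    unfolding standardization_def using assms by (intro the1_equality) simp_all
qed

theorem theorem5p6:
  fixes n k :: nat and \<sigma> :: "nat \<Rightarrow> nat \<Rightarrow> nat"
  assumes "k \<ge> 2"
    and "\<And>i. 1 \<le> i \<Longrightarrow> i \<le> k \<Longrightarrow> \<sigma> i permutes {1..n}"
    and "allowable_sequence n k \<sigma>"
  shows "\<exists>\<tau>. standard_PCT n k \<tau> \<and> (\<forall>i. 1 \<le> i \<and> i \<le> k \<longrightarrow> column_st n \<tau> i = \<sigma> i)"
proof -
  let ?C = "{1..n} \<times> {1..k}"
  have "1 \<le> k" using assms(1) by simp
  from allowable_sequence_filling[OF this assms(2,3)]
  obtain \<tau> :: "nat \<Rightarrow> nat \<Rightarrow> nat" where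
    inj: "inj_on (\<lambda>(i, j). \<tau> i j) ?C" and
    ord: "\<And>j i r. j \<in> {1..k} \<Longrightarrow> i \<in> {1..n} \<Longrightarrow> r \<in> {1..n} \<Longrightarrow>
      \<tau> i j < \<tau> r j \<longleftrightarrow> \<sigma> j i < \<sigma> j r" and
    rows: "rows_decreasing n k \<tau>" and triple: "triple_condition n k \<tau>"
    by auto
  define S where "S = (\<lambda>(i, j). \<tau> i j) ` ?C"
  have "finite S" by (simp add: S_def)
  then obtain h :: "nat \<Rightarrow> nat" where h: "bij_betw h S {1..card S}"
    and h_less: "\<And>x y. x \<in> S \<Longrightarrow> y \<in> S \<Longrightarrow> h x < h y \<longleftrightarrow> x < y"
    using finite_rank by blast
  have card: "card S = k * n" using card_image[OF inj] by (simp add: S_def)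
  have less: "h (\<tau> i j) < h (\<tau> r l) \<longleftrightarrow> \<tau> i j < \<tau> r l"
    if "i \<in> {1..n}" "r \<in> {1..n}" "j \<in> {1..k}" "l \<in> {1..k}" for i j r l
    using that by (intro h_less) (force simp: S_def)+
  have "bij_betw (h \<circ> (\<lambda>(i, j). \<tau> i j)) ?C {1..k * n}"
    using inj h card by (intro bij_betw_trans[of _ _ S]) (simp_all add: bij_betw_def S_def)
  then have "bij_betw (\<lambda>(i, j). h (\<tau> i j)) ?C {1..k * n}"
    by (simp add: comp_def case_prod_unfold)
  moreover have "rows_decreasing n k (\<lambda>i j. h (\<tau> i j))"
    using rows less by (simp add: rows_decreasing_def)
  \<comment> \<open>Weak inequalities are rewritten as negated strict ones, the form to which
    \<open>less\<close> applies.\<close>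
  moreover have "triple_condition n k (\<lambda>i j. h (\<tau> i j))"
    using triple less by (simp add: triple_condition_def flip: not_less)
  moreover have "column_st n (\<lambda>i j. h (\<tau> i j)) j = \<sigma> j" if "1 \<le> j \<and> j \<le> k" for j
    unfolding column_st_def using that ord less assms(2)
    by (intro standardization_eqI) simp_all
  ultimately show ?thesis unfolding standard_PCT_def by blast
qed

end
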